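(* Let $(X,\mathcal E)$ be a locally finite connected graph with symmetric edge weights $\mu_{xy}=\mu_{yx}>0$, and let $Q:X\to\mathbb R$. For every finite nonempty set $S\subset X$ there exists a constant $C=C(S)$ (depending on $S$, on the weighted graph and on $Q$, but not on $u$) such that every function $u:X\to\mathbb R$ with $u\ge 0$ and $-\Delta u+Qu=0$ on $X$ satisfies $$\sup_{S}u\le C\inf_{S}u.$$
   Context: A locally finite connected graph $(X,\mathcal E)$ is a simple (no loops, no multiple edges), connected graph with countable vertex set $X$ and edge set $\mathcal E$ in which each vertex has finitely many neighbors. It carries a symmetric weight $\mu_{xy}=\mu_{yx}>0$ on $\mathcal E$, and $d_x=\sum_{y:(x,y)\in\mathcal E}\mu_{xy}<\infty$ is the degree of $x$. For $u:X\to\mathbb R$, the Laplacian is $(\Delta u)(x)=\sum_{y:(x,y)\in\mathcal E}\frac{\mu_{xy}}{d_x}(u(y)-u(x))$. *)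

theory Defs
  imports Complex_Main "HOL-Library.Countable_Set" "Graph_Theory.Digraph_Component"
begin

text \<open>
  An undirected simple graph is a symmetric loop-free pair digraph, so each edge occurs in both
  orientations and parallel edges are excluded by the representation.  Values of \<open>\<mu>\<close> at
  non-adjacent pairs are unconstrained; they do not enter any of the definitions below.
\<close>

locale loc_finite_weighted_graph = pair_bidirected_digraph G
  for G :: "'a pair_pre_digraph" +
  fixes \<mu> :: "'a \<Rightarrow> 'a \<Rightarrow> real"
  assumes countable_verts: "countable (pverts G)"
    and connected: "connected (with_proj G)"
    and locally_finite: "x \<in> pverts G \<Longrightarrow> finite {y. (x, y) \<in> parcs G}"
    and weight_sym: "(x, y) \<in> parcs G \<Longrightarrow> \<mu> x y = \<mu> y x"
    and weight_pos: "(x, y) \<in> parcs G \<Longrightarrow> 0 < \<mu> x y"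

definition wdegree :: "'a pair_pre_digraph \<Rightarrow> ('a \<Rightarrow> 'a \<Rightarrow> real) \<Rightarrow> 'a \<Rightarrow> real" where
  "wdegree G \<mu> x = (\<Sum>y | (x, y) \<in> parcs G. \<mu> x y)"

text \<open>
  A function on the vertex set is represented by a total function on \<open>'a\<close>; at a vertex,
  the Laplacian only depends on the values at vertices.
\<close>

definition laplacian ::
    "'a pair_pre_digraph \<Rightarrow> ('a \<Rightarrow> 'a \<Rightarrow> real) \<Rightarrow> ('a \<Rightarrow> real) \<Rightarrow> 'a \<Rightarrow> real" where
  "laplacian G \<mu> u x = (\<Sum>y | (x, y) \<in> parcs G. \<mu> x y / wdegree G \<mu> x * (u y - u x))"

end

theory Submission
  imports Defs
begin

text \<open>
  At a vertex \<open>x\<close> the equation says that the weighted sum of \<open>u\<close> over the neighbours of \<open>x\<close> equals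
  \<open>d\<^sub>x (1 + Q x) u x\<close>.  Since \<open>u \<ge> 0\<close>, each single term of that sum is bounded by the right-hand
  side, so the values of \<open>u\<close> at adjacent vertices are comparable with a constant independent of
  \<open>u\<close>.  Multiplying these constants along paths compares any two vertices of the connected graph,
  and finitely many pairs suffice for \<open>S\<close>.
\<close>

text \<open>Bundles the two hypotheses on \<open>u\<close>, so that the later lemmas can choose
  their constants before quantifying over \<open>u\<close>.\<close>

definition nonneg_solution ::
    "'a pair_pre_digraph \<Rightarrow> ('a \<Rightarrow> 'a \<Rightarrow> real) \<Rightarrow> ('a \<Rightarrow> real) \<Rightarrow> ('a \<Rightarrow> real) \<Rightarrow> bool" where
  "nonneg_solution G \<mu> Q u \<longleftrightarrow>
    (\<forall>x\<in>pverts G. 0 \<le> u x) \<and> (\<forall>x\<in>pverts G. - laplacian G \<mu> u x + Q x * u x = 0)"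

context loc_finite_weighted_graph
begin

lemma wdegree_pos:
  assumes "(x, y) \<in> parcs G"
  shows "0 < wdegree G \<mu> x"
  unfolding wdegree_def
proof (rule sum_pos)
  show "finite {y. (x, y) \<in> parcs G}"
    using assms locally_finite pair_wf_digraph.in_arcsD1 pair_wf_digraph_axioms by metis
qed (use assms weight_pos in auto)

text \<open>The arc makes the degree of \<open>x\<close> positive, so multiplying by it cancels the
  normalisation in \<open>laplacian\<close>.\<close>

lemma wdegree_laplacian:
  assumes "(x, y) \<in> parcs G"
  shows "wdegree G \<mu> x * laplacian G \<mu> u x
    = (\<Sum>z | (x, z) \<in> parcs G. \<mu> x z * u z) - wdegree G \<mu> x * u x"
proof -
  have "wdegree G \<mu> x * laplacian G \<mu> u x = (\<Sum>z | (x, z) \<in> parcs G. \<mu> x z * (u z - u x))"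
    using wdegree_pos[OF assms] by (simp add: laplacian_def sum_distrib_left)
  also have "\<dots> = (\<Sum>z | (x, z) \<in> parcs G. \<mu> x z * u z) - wdegree G \<mu> x * u x"
    by (simp add: right_diff_distrib sum_subtractf wdegree_def sum_distrib_right)
  finally show ?thesis .
qed

lemma solution_le_neighbour:
  assumes arc: "(x, y) \<in> parcs G" and sol: "nonneg_solution G \<mu> Q u"
  shows "u y \<le> wdegree G \<mu> x * (1 + Q x) / \<mu> x y * u x"
proof -
  have verts: "z \<in> pverts G" if "(x, z) \<in> parcs G" for z
    using that in_arcsD2 by blast
  have x: "x \<in> pverts G"
    using arc in_arcsD1 by blast
  have "\<mu> x y * u y \<le> (\<Sum>z | (x, z) \<in> parcs G. \<mu> x z * u z)"
    using arc sol verts locally_finite[OF x]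
    by (intro member_le_sum) (auto simp: nonneg_solution_def less_imp_le weight_pos)
  also have "\<dots> = wdegree G \<mu> x * (laplacian G \<mu> u x + u x)"
    using wdegree_laplacian[OF arc, of u] by (simp add: distrib_left)
  also have "\<dots> = wdegree G \<mu> x * (1 + Q x) * u x"
    using sol x by (simp add: nonneg_solution_def algebra_simps)
  finally show ?thesis
    using weight_pos[OF arc] by (simp add: field_simps)
qed

text \<open>Induction along a walk from \<open>x\<close> to \<open>y\<close>, multiplying one factor
  per arc. The bound \<open>C \<ge> 0\<close> is carried along so that the constants of different
  pairs can later be added up.\<close>

lemma solution_comparable:
  assumes "x \<in> pverts G" and "y \<in> pverts G"
  shows "\<exists>C\<ge>0. \<forall>u. nonneg_solution G \<mu> Q u \<longrightarrow> u y \<le> C * u x"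
proof -
  \<comment> \<open>\<open>connected\<close> speaks of reachability in the symmetric closure; the
    arcs being symmetric, this is reachability in \<open>G\<close> itself.\<close>
  have "x \<rightarrow>\<^sup>*\<^bsub>with_proj G\<^esub> y"
    using connected assms reachable_mk_symmetric_eq[OF sym_arcs]
    by (auto simp: connected_def strongly_connected_def)
  then show ?thesis
  proof (induction rule: reachable_induct)
    case base
    show ?case
      by (rule exI[of _ 1]) simp
  next
    case (step y z)
    then obtain C where C: "C \<ge> 0" "\<And>u. nonneg_solution G \<mu> Q u \<Longrightarrow> u y \<le> C * u x"
      by blast
    have arc: "(y, z) \<in> parcs G"
      using step.hyps(2) by simp
    \<comment> \<open>\<open>1 + Q y\<close> may be negative, as \<open>Q\<close> is arbitrary. The
      absolute value keeps the bound valid because \<open>u y\<close> is nonnegative, and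
      \<open>K \<ge> 0\<close> lets the induction bound be multiplied by \<open>K\<close>.\<close>
    define K where "K = \<bar>wdegree G \<mu> y * (1 + Q y) / \<mu> y z\<bar>"
    have "u z \<le> K * C * u x" if sol: "nonneg_solution G \<mu> Q u" for u
    proof -
      have "0 \<le> u y"
        using sol arc in_arcsD1 by (auto simp: nonneg_solution_def)
      then have "u z \<le> K * u y"
        using solution_le_neighbour[OF arc sol] unfolding K_def
        by (meson abs_ge_self mult_right_mono order_trans)
      also have "\<dots> \<le> K * (C * u x)"
        using C(2)[OF sol] by (intro mult_left_mono) (simp_all add: K_def)
      finally show ?thesis
        by (simp add: mult.assoc)
    qed
    moreover have "0 \<le> K * C"
      using C(1) by (simp add: K_def)
    ultimately show ?case
      by blast
  qed
qed

lemma solution_comparable_on_finite: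
  assumes "finite S" and "S \<subseteq> pverts G"
  shows "\<exists>C. \<forall>u. nonneg_solution G \<mu> Q u \<longrightarrow> (\<forall>x\<in>S. \<forall>y\<in>S. u y \<le> C * u x)"
proof -
  have "\<forall>p\<in>S \<times> S. \<exists>C\<ge>0. \<forall>u. nonneg_solution G \<mu> Q u \<longrightarrow> u (snd p) \<le> C * u (fst p)"
    using solution_comparable assms(2) by fastforce
  then obtain c where c: "\<And>p. p \<in> S \<times> S \<Longrightarrow> 0 \<le> c p"
      "\<And>p u. p \<in> S \<times> S \<Longrightarrow> nonneg_solution G \<mu> Q u \<Longrightarrow> u (snd p) \<le> c p * u (fst p)"
    by metis
  \<comment> \<open>The sum of the nonnegative constants dominates each of them, and
    \<open>u x \<ge> 0\<close> preserves the estimate.\<close>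
  have "u y \<le> sum c (S \<times> S) * u x"
    if sol: "nonneg_solution G \<mu> Q u" and xy: "x \<in> S" "y \<in> S" for u x y
  proof -
    have "u y \<le> c (x, y) * u x"
      using c(2)[of "(x, y)" u] sol xy by simp
    also have "\<dots> \<le> sum c (S \<times> S) * u x"
      using sol xy assms c(1)
      by (intro mult_right_mono member_le_sum) (auto simp: nonneg_solution_def)
    finally show ?thesis .
  qed
  then show ?thesis
    by blast
qed

end

theorem theorem2p4:
  fixes G :: "'a pair_pre_digraph" and \<mu> :: "'a \<Rightarrow> 'a \<Rightarrow> real"
    and Q :: "'a \<Rightarrow> real" and S :: "'a set"
  assumes "loc_finite_weighted_graph G \<mu>"
    and "finite S" and "S \<noteq> {}" and "S \<subseteq> pverts G"
  shows "\<exists>C::real. \<forall>u :: 'a \<Rightarrow> real.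
    (\<forall>x\<in>pverts G. 0 \<le> u x) \<longrightarrow>
    (\<forall>x\<in>pverts G. - laplacian G \<mu> u x + Q x * u x = 0) \<longrightarrow>
    (SUP x\<in>S. u x) \<le> C * (INF x\<in>S. u x)"
proof -
  interpret loc_finite_weighted_graph G \<mu>
    by fact
  obtain C where C: "\<And>u x y. nonneg_solution G \<mu> Q u \<Longrightarrow> x \<in> S \<Longrightarrow> y \<in> S \<Longrightarrow> u y \<le> C * u x"
    using solution_comparable_on_finite[OF assms(2,4)] by blast
  have "(SUP x\<in>S. u x) \<le> C * (INF x\<in>S. u x)" if sol: "nonneg_solution G \<mu> Q u" for u
  proof -
    \<comment> \<open>On a finite nonempty set the infimum is attained, so it suffices to compare
      every value with the one at a minimiser.\<close>
    have "Inf (u ` S) \<in> u ` S"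
      using assms(2,3) by (simp add: cInf_eq_Min del: Min_in) (rule Min_in, auto)
    then obtain x where "x \<in> S" "(INF x\<in>S. u x) = u x"
      by auto
    then show ?thesis
      using C[OF sol] assms(3) by (auto intro: cSUP_least)
  qed
  then show ?thesis
    by (auto simp: nonneg_solution_def)
qed

end
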